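(* Let $t\ge 1$ be an integer. Let $M=(m_{i,j})_{i,j\ge 1}$ be the infinite lower triangular matrix (so $m_{i,j}=0$ for $j>i$) such that, for every $i\ge 1$, $m_{i,1}$ is the number of $(t^2-t)$-Dyck paths of length $2i$, and such that for all $i\ge 2$ and $j\ge 2$ $$m_{i,j}=m_{i-1,j-1}+(t^2-t+1)\,m_{i-1,j}+(t^2-t)\,m_{i-1,j+1}.$$ Then $$M\begin{bmatrix}1\\ t^2-(t-1)^2\\ t^3-(t-1)^3\\ \vdots\end{bmatrix}=\begin{bmatrix}1\\ t^2+t\\ (t^2+t)^2\\ \vdots\end{bmatrix},$$ that is, $\sum_{j=1}^{i} m_{i,j}\,\bigl(t^j-(t-1)^j\bigr)=(t^2+t)^{i-1}$ for every $i\ge 1$.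
   Context: A Dyck path of length $2n$ is a lattice path from $(0,0)$ to $(2n,0)$ with up steps $U=(1,1)$ and down steps $D=(1,-1)$ that never goes below the $x$-axis. For an integer $k\ge 0$, a $k$-Dyck path is a Dyck path in which each up step that is not immediately followed by a down step is colored with one of $k$ colors $\{1,\dots,k\}$ (up steps immediately followed by a down step are uncolored). *)

theory Defs
  imports "HOL-Library.FuncSet"
begin

text \<open>Since both steps advance the abscissa by one, a lattice path starting at the origin
  is determined by its list of steps; its endpoint is (length, height).\<close>

datatype step = U | D

fun rise :: "step \<Rightarrow> int" where
  "rise U = 1"
| "rise D = -1"

definition height :: "step list \<Rightarrow> int" where
  "height p = sum_list (map rise p)"

definition dyck_paths :: "nat \<Rightarrow> step list set" where
  "dyck_paths n =
     {p. length p = 2 * n \<and> height p = 0 \<and> (\<forall>i \<le> length p. height (take i p) \<ge> 0)}"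

definition coloured_steps :: "step list \<Rightarrow> nat set" where
  "coloured_steps p =
     {i. i < length p \<and> p ! i = U \<and> \<not> (Suc i < length p \<and> p ! Suc i = D)}"

text \<open>A colouring is an extensional function on the positions of the steps to be coloured,
  so that distinct elements of the following set are distinct coloured paths.
  The parameter \<open>n\<close> is the semilength.\<close>

definition k_dyck_paths :: "nat \<Rightarrow> nat \<Rightarrow> (step list \<times> (nat \<Rightarrow> nat)) set" where
  "k_dyck_paths k n = (SIGMA p : dyck_paths n. coloured_steps p \<rightarrow>\<^sub>E {1..k})"

lemma finite_dyck_paths: "finite (dyck_paths n)"
proof (rule finite_subset)
  have "(UNIV :: step set) = {U, D}"
    using step.exhaust by auto
  then have "finite (UNIV :: step set)"
    by (metis finite.emptyI finite.insertI)
  then show "finite {p :: step list. set p \<subseteq> UNIV \<and> length p = 2 * n}"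
    by (rule finite_lists_length_eq)
qed (auto simp: dyck_paths_def)

lemma finite_k_dyck_paths: "finite (k_dyck_paths k n)"
  unfolding k_dyck_paths_def coloured_steps_def
  by (intro finite_SigmaI finite_dyck_paths finite_PiE) auto

end

theory Submission
  imports Defs "HOL-Computational_Algebra.Formal_Power_Series"
begin

text \<open>
  Write \<open>k = t\<^sup>2 - t\<close>, and let \<open>g\<close> be the generating function of the nonempty \<open>k\<close>-Dyck paths.
  The first-return decomposition gives \<open>g = x (1 + g) (1 + k g)\<close>. Multiplying this by
  \<open>g ^ (j - 1)\<close> yields exactly the recurrence of the array, so the \<open>j\<close>-th column has generating
  function \<open>g ^ j\<close>, and the recurrence extends to the first column with \<open>m\<^sub>i\<^sub>,\<^sub>0 = 0\<close>.
  Finally \<open>r\<^sup>2 + (k + 1) r + k = (t\<^sup>2 + t) r\<close> for both \<open>r = t\<close> and \<open>r = t - 1\<close>, so each row sum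
  is \<open>t\<^sup>2 + t\<close> times the preceding one.
\<close>

section \<open>Weighted paths\<close>

text \<open>Removing the first step of a Dyck path leaves the axis, so induction on the length needs
  paths that start at an arbitrary height \<open>h\<close>.\<close>

definition descents_from :: "nat \<Rightarrow> nat \<Rightarrow> step list set" where
  "descents_from n h =
     {p. length p = n \<and> int h + height p = 0 \<and> (\<forall>i \<le> length p. 0 \<le> int h + height (take i p))}"

lemma height_Nil [simp]: "height [] = 0"
  and height_Cons [simp]: "height (s # p) = rise s + height p"
  by (simp_all add: height_def)

lemma dyck_paths_eq_descents_from: "dyck_paths n = descents_from (2 * n) 0"
  by (auto simp: dyck_paths_def descents_from_def)

lemma descents_from_0: "descents_from 0 h = (if h = 0 then {[]} else {})"
  by (auto simp: descents_from_def)

lemma all_le_Suc_iff: "(\<forall>i\<le>Suc n. P i) \<longleftrightarrow> P 0 \<and> (\<forall>i\<le>n. P (Suc i))"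
  using less_Suc_eq_0_disj by (auto simp flip: less_Suc_eq_le)

lemma U_Cons_in_descents_from_iff:
  "U # p \<in> descents_from (Suc n) h \<longleftrightarrow> p \<in> descents_from n (Suc h)"
  by (auto simp: descents_from_def all_le_Suc_iff algebra_simps)

lemma D_Cons_in_descents_from_Suc_iff:
  "D # p \<in> descents_from (Suc n) (Suc h) \<longleftrightarrow> p \<in> descents_from n h"
  by (auto simp: descents_from_def all_le_Suc_iff algebra_simps)

lemma D_Cons_notin_descents_from_0: "D # p \<notin> descents_from n 0"
proof
  assume "D # p \<in> descents_from n 0"
  then have "0 \<le> int 0 + height (take 1 (D # p))"
    unfolding descents_from_def by (metis (mono_tags, lifting) Suc_leI length_Cons mem_Collect_eq One_nat_def zero_less_Suc)
  then show False by simp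
qed

lemma descents_from_Suc:
  "descents_from (Suc n) h =
     (#) U ` descents_from n (Suc h) \<union> (case h of 0 \<Rightarrow> {} | Suc h' \<Rightarrow> (#) D ` descents_from n h')"
  (is "?L = ?R")
proof (rule set_eqI)
  fix p
  show "p \<in> ?L \<longleftrightarrow> p \<in> ?R"
  proof (cases p)
    case Nil
    then show ?thesis by (auto simp: descents_from_def split: nat.splits)
  next
    case (Cons s q)
    then show ?thesis
      by (cases s) (auto simp: U_Cons_in_descents_from_iff D_Cons_in_descents_from_Suc_iff
          D_Cons_notin_descents_from_0 split: nat.splits)
  qed
qed

lemma finite_descents_from: "finite (descents_from n h)"
  by (induction n arbitrary: h) (auto simp: descents_from_0 descents_from_Suc split: nat.splits)

lemma sum_descents_from_Suc:
  fixes f :: "step list \<Rightarrow> 'a :: comm_monoid_add"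
  shows "sum f (descents_from (Suc n) h) = (\<Sum>p\<in>descents_from n (Suc h). f (U # p)) +
    (case h of 0 \<Rightarrow> 0 | Suc h' \<Rightarrow> \<Sum>p\<in>descents_from n h'. f (D # p))"
proof -
  have "sum f (descents_from (Suc n) h) = sum f ((#) U ` descents_from n (Suc h)) +
    sum f (case h of 0 \<Rightarrow> {} | Suc h' \<Rightarrow> (#) D ` descents_from n h')"
    unfolding descents_from_Suc
    by (rule sum.union_disjoint) (auto simp: finite_descents_from split: nat.splits)
  then show ?thesis
    by (auto simp: sum.reindex split: nat.splits)
qed

lemma descents_from_empty: "n < h \<Longrightarrow> descents_from n h = {}"
  by (induction n arbitrary: h) (auto simp: descents_from_0 descents_from_Suc split: nat.splits)

lemma finite_coloured_steps: "finite (coloured_steps p)"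
  by (simp add: coloured_steps_def)

lemma coloured_steps_Nil: "coloured_steps [] = {}"
  by (simp add: coloured_steps_def)

lemma coloured_steps_Cons:
  "coloured_steps (s # p) =
     (if s = U \<and> \<not> (p \<noteq> [] \<and> hd p = D) then {0} else {}) \<union> Suc ` coloured_steps p"
  (is "?L = ?R")
proof (rule set_eqI)
  fix i
  show "i \<in> ?L \<longleftrightarrow> i \<in> ?R"
    by (cases i) (auto simp: coloured_steps_def hd_conv_nth)
qed

lemma card_coloured_steps_D_Cons: "card (coloured_steps (D # p)) = card (coloured_steps p)"
  by (simp add: coloured_steps_Cons card_image)

lemma card_coloured_steps_UD_Cons: "card (coloured_steps (U # D # p)) = card (coloured_steps p)"
  by (simp add: coloured_steps_Cons[of U] card_image card_coloured_steps_D_Cons)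

lemma card_coloured_steps_UU_Cons:
  "card (coloured_steps (U # U # p)) = Suc (card (coloured_steps (U # p)))"
  by (simp add: coloured_steps_Cons[of U "U # p"] card_image card_insert_if finite_coloured_steps)

text \<open>A path with \<open>c\<close> coloured steps has \<open>k ^ c\<close> colourings, so this
  counts coloured paths.\<close>

definition weight :: "nat \<Rightarrow> nat \<Rightarrow> nat \<Rightarrow> nat" where
  "weight k n h = (\<Sum>p\<in>descents_from n h. k ^ card (coloured_steps p))"

text \<open>An up step is coloured or not according to its successor. A recursion on the first step
  therefore needs a second weight, which also charges for an up step just removed.\<close>

definition weight_after_U :: "nat \<Rightarrow> nat \<Rightarrow> nat \<Rightarrow> nat" where
  "weight_after_U k n h = (\<Sum>p\<in>descents_from n h. k ^ card (coloured_steps (U # p)))"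

lemma weight_0: "weight k 0 h = (if h = 0 then 1 else 0)"
  by (simp add: weight_def descents_from_0 coloured_steps_Nil)

lemma weight_Suc:
  "weight k (Suc n) h = weight_after_U k n (Suc h) + (case h of 0 \<Rightarrow> 0 | Suc h' \<Rightarrow> weight k n h')"
  unfolding weight_def weight_after_U_def sum_descents_from_Suc
  by (simp add: card_coloured_steps_D_Cons split: nat.splits)

lemma weight_after_U_Suc:
  "weight_after_U k (Suc n) (Suc h) = k * weight_after_U k n (Suc (Suc h)) + weight k n h"
  unfolding weight_def weight_after_U_def sum_descents_from_Suc
  by (simp add: card_coloured_steps_UD_Cons card_coloured_steps_UU_Cons sum_distrib_left)

lemma weight_after_U_eq_0: "n < h \<Longrightarrow> weight_after_U k n h = 0"
  by (simp add: weight_after_U_def descents_from_empty)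

lemma card_k_dyck_paths: "card (k_dyck_paths k n) = weight k (2 * n) 0"
  unfolding k_dyck_paths_def weight_def dyck_paths_eq_descents_from
  by (subst card_SigmaI)
    (auto simp: finite_descents_from finite_coloured_steps card_PiE intro!: finite_PiE)

section \<open>Generating functions\<close>

text \<open>The equation says that \<open>g\<close> is the compositional inverse of
  \<open>p = X / ((1 + X) (1 + k X))\<close>, which exists because \<open>p\<close> has zero
  constant term and linear coefficient 1.\<close>

lemma exists_k_dyck_series:
  fixes k :: "'a :: field"
  shows "\<exists>g. g = fps_X * ((1 + g) * (1 + fps_const k * g))"
proof -
  define q :: "'a fps" where "q = (1 + fps_X) * (1 + fps_const k * fps_X)"
  define p where "p = fps_X * inverse q"
  define g where "g = fps_inv p"
  have g0: "fps_nth g 0 = 0"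
    by (simp add: g_def fps_inv_def)
  have q0: "fps_nth q 0 = 1"
    by (simp add: q_def)
  have "p oo g = fps_X"
    unfolding g_def by (rule fps_inv_right) (simp_all add: p_def q0)
  then have "g * (inverse q oo g) = fps_X"
    by (simp add: p_def fps_compose_mult_distrib g0)
  moreover have "(inverse q oo g) * (q oo g) = 1"
    using q0 by (simp flip: fps_compose_mult_distrib[OF g0] add: inverse_mult_eq_1)
  ultimately have "g = fps_X * (q oo g)"
    by (metis mult.assoc mult.right_neutral)
  moreover have "q oo g = (1 + g) * (1 + fps_const k * g)"
    by (simp add: q_def fps_compose_mult_distrib g0 fps_compose_add_distrib)
  ultimately show ?thesis by metis
qed

context
  fixes k :: nat and g :: "'a :: comm_ring_1 fps"
  assumes g_eq: "g = fps_X * ((1 + g) * (1 + of_nat k * g))"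
begin

lemma k_dyck_series_nth_0: "fps_nth g 0 = 0"
  by (subst g_eq) simp

text \<open>Cutting a path at its first visit to each of the levels \<open>h - 1, \<dots>, 0\<close> leaves \<open>h + 1\<close>
  Dyck paths. Directly after an up step, the first of them contributes \<open>1 + k g\<close> instead of
  \<open>1 + g\<close>, since that up step is coloured iff this Dyck path is nonempty.\<close>

lemma weight_eq_nth:
  assumes "n = h + 2 * m"
  shows "of_nat (weight k n h) = fps_nth ((1 + g) ^ Suc h) m"
    and "h \<ge> 1 \<Longrightarrow> of_nat (weight_after_U k n h) = fps_nth ((1 + of_nat k * g) * (1 + g) ^ h) m"
proof -
  \<comment> \<open>One use of the functional equation trades a factor \<open>g\<close> for a factor
    X: \<open>m\<close> drops by one while the level rises by one, as after an up step.\<close>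
  have mult_g: "fps_nth (g * (1 + g) ^ h) m =
      (if m = 0 then 0 else fps_nth ((1 + of_nat k * g) * (1 + g) ^ Suc h) (m - 1))" for h m
  proof -
    have "g * (1 + g) ^ h = fps_X * ((1 + of_nat k * g) * (1 + g) ^ Suc h)"
      by (subst (1) g_eq) (simp add: mult_ac)
    then show ?thesis by (simp only: fps_X_mult_nth)
  qed
  \<comment> \<open>Each recursion involves both weights, so both claims go through one induction.
    Level 0 is left out of the second: at \<open>n = h = 0\<close> the final up step would count as
    coloured, giving \<open>k\<close> instead of 1.\<close>
  have "of_nat (weight k n h) = fps_nth ((1 + g) ^ Suc h) m \<and>
    (h \<ge> 1 \<longrightarrow> of_nat (weight_after_U k n h) = fps_nth ((1 + of_nat k * g) * (1 + g) ^ h) m)"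
    using assms
  proof (induction n arbitrary: h m)
    case 0
    then show ?case by (simp add: weight_0 k_dyck_series_nth_0)
  next
    case (Suc n)
    have up: "of_nat (weight_after_U k n (Suc h)) = fps_nth (g * (1 + g) ^ h) m"
    proof (cases m)
      case 0
      then show ?thesis using Suc.prems by (simp add: k_dyck_series_nth_0 weight_after_U_eq_0)
    next
      case (Suc m')
      then show ?thesis
        using Suc.prems Suc.IH[of "Suc h" m'] by (simp add: mult_g)
    qed
    show ?case
    proof (cases h)
      case 0
      then have "m > 0" using Suc.prems by simp
      then show ?thesis using 0 up by (simp add: weight_Suc)
    next
      case (Suc h')
      have down: "of_nat (weight k n h') = fps_nth ((1 + g) ^ h) m"
        using Suc.prems Suc.IH[of h' m] Suc by simp
      \<comment> \<open>In both identities the summand with \<open>g\<close> accounts for an up step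
        next, the other for a down step.\<close>
      have split: "(1 + g) ^ Suc h = g * (1 + g) ^ h + (1 + g) ^ h"
        "(1 + of_nat k * g) * (1 + g) ^ h = fps_const (of_nat k) * (g * (1 + g) ^ h) + (1 + g) ^ h"
        by (simp_all add: algebra_simps fps_of_nat)
      have "of_nat (weight k (Suc n) h) = fps_nth ((1 + g) ^ Suc h) m"
        using Suc up down unfolding split by (simp add: weight_Suc del: power_Suc)
      moreover have "of_nat (weight_after_U k (Suc n) h) =
          fps_nth ((1 + of_nat k * g) * (1 + g) ^ h) m"
        using Suc up down unfolding split by (simp add: weight_after_U_Suc del: power_Suc)
      ultimately show ?thesis by blast
    qed
  qed
  then show "of_nat (weight k n h) = fps_nth ((1 + g) ^ Suc h) m"
    and "h \<ge> 1 \<Longrightarrow> of_nat (weight_after_U k n h) = fps_nth ((1 + of_nat k * g) * (1 + g) ^ h) m"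
    by simp_all
qed

text \<open>This is level 0 of \<open>weight_eq_nth\<close>; the series \<open>1 + g\<close> and
  \<open>g\<close> differ only in the term of the empty path.\<close>

lemma card_k_dyck_paths_eq_nth:
  assumes "n \<ge> 1"
  shows "of_nat (card (k_dyck_paths k n)) = fps_nth g n"
  using weight_eq_nth(1)[of "2 * n" 0 n] assms by (simp add: card_k_dyck_paths)

text \<open>The case \<open>j = 0\<close> is included on purpose: there \<open>g ^ j = 1\<close>
  contributes nothing for \<open>i \<ge> 1\<close>, which yields the recurrence of the first
  column.\<close>

lemma k_dyck_series_power_nth_Suc:
  "fps_nth (g ^ Suc j) (Suc i) =
     fps_nth (g ^ j) i + (of_nat k + 1) * fps_nth (g ^ Suc j) i + of_nat k * fps_nth (g ^ Suc (Suc j)) i"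
proof -
  have "g ^ Suc j = fps_X * (g ^ j * ((1 + g) * (1 + of_nat k * g)))"
    unfolding power_Suc by (subst (1) g_eq) (simp only: mult_ac)
  also have "g ^ j * ((1 + g) * (1 + of_nat k * g)) =
      g ^ j + fps_const (of_nat k + 1) * g ^ Suc j + fps_const (of_nat k) * g ^ Suc (Suc j)"
    using fps_of_nat[of k, where 'a = 'a] fps_of_nat[of "Suc k", where 'a = 'a]
    by (simp add: algebra_simps)
  finally have "fps_nth (g ^ Suc j) (Suc i) = fps_nth (fps_X *
      (g ^ j + fps_const (of_nat k + 1) * g ^ Suc j + fps_const (of_nat k) * g ^ Suc (Suc j))) (Suc i)"
    by (rule arg_cong)
  then show ?thesis by (simp del: power_Suc)
qed

lemma column_eq_k_dyck_series_power:
  fixes M :: "nat \<Rightarrow> nat \<Rightarrow> 'a"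
  assumes lower_triangular: "\<And>i j. 1 \<le> i \<Longrightarrow> i < j \<Longrightarrow> M i j = 0"
    and first_column: "\<And>i. 1 \<le> i \<Longrightarrow> M i 1 = of_nat (card (k_dyck_paths k i))"
    and recurrence: "\<And>i j. 2 \<le> i \<Longrightarrow> 2 \<le> j \<Longrightarrow>
      M i j = M (i - 1) (j - 1) + (of_nat k + 1) * M (i - 1) j + of_nat k * M (i - 1) (j + 1)"
  shows "M (Suc i) (Suc j) = fps_nth (g ^ Suc j) (Suc i)"
proof (induction i arbitrary: j)
  case 0
  show ?case
  proof (cases j)
    case 0
    then show ?thesis
      using first_column[of 1] card_k_dyck_paths_eq_nth[of 1] by simp
  next
    case (Suc j')
    \<comment> \<open>The power \<open>g ^ Suc j\<close> is divisible by \<open>X ^ Suc j\<close>,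
      and here \<open>Suc j \<ge> 2\<close>.\<close>
    have "fps_nth (g ^ Suc j) 1 = 0"
      using Suc startsby_zero_power_prefix[OF k_dyck_series_nth_0, of "Suc j"] by (simp del: power_Suc)
    with Suc show ?thesis
      using lower_triangular[of 1 "Suc j"] by simp
  qed
next
  case (Suc i)
  show ?case
  proof (cases j)
    case 0
    then show ?thesis
      using first_column[of "Suc (Suc i)"] card_k_dyck_paths_eq_nth[of "Suc (Suc i)"] by simp
  next
    case (Suc j')
    then show ?thesis
      using recurrence[of "Suc (Suc i)" "Suc j"] Suc.IH
      by (simp add: k_dyck_series_power_nth_Suc[of "Suc j'" "Suc i"] del: power_Suc)
  qed
qed

end

text \<open>This is the recurrence at \<open>j = 1\<close> with a zero column 0. The series is taken
  over the rationals, because its existence was shown over a field; injectivity of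
  \<open>of_int\<close> brings the identity back.\<close>

lemma first_column_recurrence:
  fixes M :: "nat \<Rightarrow> nat \<Rightarrow> int"
  assumes lower_triangular: "\<And>i j. 1 \<le> i \<Longrightarrow> i < j \<Longrightarrow> M i j = 0"
    and first_column: "\<And>i. 1 \<le> i \<Longrightarrow> M i 1 = int (card (k_dyck_paths k i))"
    and recurrence: "\<And>i j. 2 \<le> i \<Longrightarrow> 2 \<le> j \<Longrightarrow>
      M i j = M (i - 1) (j - 1) + (int k + 1) * M (i - 1) j + int k * M (i - 1) (j + 1)"
    and "i \<ge> 1"
  shows "M (Suc i) 1 = (int k + 1) * M i 1 + int k * M i 2"
proof -
  obtain g :: "rat fps" where g: "g = fps_X * ((1 + g) * (1 + of_nat k * g))"
    using exists_k_dyck_series[of "of_nat k :: rat"] by (auto simp: fps_of_nat)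
  obtain i' where i': "i = Suc i'"
    using \<open>i \<ge> 1\<close> by (cases i) auto
  have M: "of_int (M (Suc i) (Suc j)) = fps_nth (g ^ Suc j) (Suc i)" for i j
    using lower_triangular first_column recurrence
    by (intro column_eq_k_dyck_series_power[OF g, where M = "\<lambda>i j. of_int (M i j)"]) simp_all
  have "(of_int (M (Suc i) 1) :: rat) = of_int ((int k + 1) * M i 1 + int k * M i 2)"
    using M[of "Suc i'" 0] M[of i' 0] M[of i' 1] k_dyck_series_power_nth_Suc[OF g, of 0 i]
    by (simp add: i' numeral_2_eq_2)
  then show ?thesis by (simp only: of_int_eq_iff)
qed

section \<open>Row sums\<close>

theorem theorem6p1:
  fixes t :: nat and M :: "nat \<Rightarrow> nat \<Rightarrow> int"
  assumes "t \<ge> 1"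
    and lower_triangular: "\<And>i j. 1 \<le> i \<Longrightarrow> i < j \<Longrightarrow> M i j = 0"
    and first_column: "\<And>i. 1 \<le> i \<Longrightarrow> M i 1 = int (card (k_dyck_paths (t^2 - t) i))"
    and recurrence: "\<And>i j. 2 \<le> i \<Longrightarrow> 2 \<le> j \<Longrightarrow>
      M i j = M (i - 1) (j - 1) + ((int t)^2 - int t + 1) * M (i - 1) j
              + ((int t)^2 - int t) * M (i - 1) (j + 1)"
  shows "\<forall>i \<ge> 1. (\<Sum>j = 1..i. M i j * ((int t)^j - (int t - 1)^j)) = ((int t)^2 + int t)^(i - 1)"
proof -
  define k where "k = t\<^sup>2 - t"
  define w where "w j = int t ^ j - (int t - 1) ^ j" for j
  have k: "int k = (int t)\<^sup>2 - int t"
    unfolding k_def using \<open>t \<ge> 1\<close> by (simp add: of_nat_diff self_le_power)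
  have w_rec: "w (Suc (Suc j)) + (int k + 1) * w (Suc j) + int k * w j = ((int t)\<^sup>2 + int t) * w (Suc j)" for j
  proof -
    \<comment> \<open>After cancelling \<open>r ^ j\<close>, the difference of the two sides is
      \<open>(r - x) (r - x + 1)\<close>. Subtracting the instances for the two roots gives the
      claim for \<open>w\<close>.\<close>
    have root: "r ^ Suc (Suc j) + (x\<^sup>2 - x + 1) * r ^ Suc j + (x\<^sup>2 - x) * r ^ j = (x\<^sup>2 + x) * r ^ Suc j"
      if "r = x \<or> r = x - 1" for r x :: int
      using that by (auto simp: power2_eq_square algebra_simps)
    show ?thesis
      using root[of "int t" "int t"] root[of "int t - 1" "int t"]
      unfolding k w_def by (simp add: right_diff_distrib)
  qed
  have first: "M (Suc i) 1 = (int k + 1) * M i 1 + int k * M i 2" if "i \<ge> 1" for i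
    using lower_triangular first_column[folded k_def] recurrence[folded k] that
    by (rule first_column_recurrence)
  have step: "(\<Sum>j<Suc i. M (Suc i) (Suc j) * w (Suc j)) =
      ((int t)\<^sup>2 + int t) * (\<Sum>j<i. M i (Suc j) * w (Suc j))" if "i \<ge> 1" for i
  proof -
    have zero: "M i (Suc i) = 0" "M i (Suc (Suc i)) = 0"
      using lower_triangular \<open>i \<ge> 1\<close> by simp_all
    have interior: "M (Suc i) (Suc (Suc j)) =
        M i (Suc j) + (int k + 1) * M i (Suc (Suc j)) + int k * M i (Suc (Suc (Suc j)))" for j
      using recurrence[of "Suc i" "Suc (Suc j)"] \<open>i \<ge> 1\<close> by (simp add: k)
    have "(\<Sum>j<Suc i. M (Suc i) (Suc j) * w (Suc j)) =
        M (Suc i) 1 * w 1 + (\<Sum>j<i. M (Suc i) (Suc (Suc j)) * w (Suc (Suc j)))"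
      by (subst sum.lessThan_Suc_shift) simp
    also have "(\<Sum>j<i. M (Suc i) (Suc (Suc j)) * w (Suc (Suc j))) =
        (\<Sum>j<i. M i (Suc j) * w (Suc (Suc j))) +
        ((int k + 1) * (\<Sum>j<i. M i (Suc (Suc j)) * w (Suc (Suc j))) +
         int k * (\<Sum>j<i. M i (Suc (Suc (Suc j))) * w (Suc (Suc j))))"
      unfolding interior by (simp add: algebra_simps sum_distrib_left sum.distrib)
    \<comment> \<open>The first-column recurrence supplies exactly the initial terms that the last
      two sums lack.\<close>
    also have "M (Suc i) 1 * w 1 + \<dots> =
        (\<Sum>j<i. M i (Suc j) * w (Suc (Suc j))) +
        ((int k + 1) * (\<Sum>j<Suc i. M i (Suc j) * w (Suc j)) +
         int k * (\<Sum>j<Suc i. M i (Suc (Suc j)) * w (Suc j)))"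
      unfolding first[OF \<open>i \<ge> 1\<close>] sum.lessThan_Suc_shift
      by (simp add: algebra_simps numeral_2_eq_2)
    also have "(\<Sum>j<Suc i. M i (Suc j) * w (Suc j)) = (\<Sum>j<i. M i (Suc j) * w (Suc j))"
      by (simp add: zero)
    \<comment> \<open>A term with \<open>w 0 = 0\<close> is prepended, so that all three sums run
      over the columns of row \<open>i\<close>; entries above the diagonal then drop out.\<close>
    also have "(\<Sum>j<Suc i. M i (Suc (Suc j)) * w (Suc j)) =
        (\<Sum>j<Suc (Suc i). M i (Suc j) * w j)"
      by (subst (2) sum.lessThan_Suc_shift) (simp add: w_def)
    also have "\<dots> = (\<Sum>j<i. M i (Suc j) * w j)"
      by (simp add: zero)
    also have "(\<Sum>j<i. M i (Suc j) * w (Suc (Suc j))) +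
        ((int k + 1) * (\<Sum>j<i. M i (Suc j) * w (Suc j)) + int k * (\<Sum>j<i. M i (Suc j) * w j)) =
        (\<Sum>j<i. M i (Suc j) * (w (Suc (Suc j)) + (int k + 1) * w (Suc j) + int k * w j))"
      by (simp add: algebra_simps sum_distrib_left sum.distrib)
    also have "\<dots> = ((int t)\<^sup>2 + int t) * (\<Sum>j<i. M i (Suc j) * w (Suc j))"
      unfolding w_rec sum_distrib_left by (simp add: mult_ac)
    finally show ?thesis .
  qed
  \<comment> \<open>The only path of semilength 1 is UD, which has no coloured step.\<close>
  have "M 1 1 = 1"
  proof -
    have "weight k 2 0 = 1"
      by (simp add: numeral_2_eq_2 weight_Suc weight_after_U_Suc weight_after_U_eq_0 weight_0)
    then show ?thesis
      using first_column[of 1] card_k_dyck_paths[of k 1] by (simp add: k_def)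
  qed
  then have "(\<Sum>j<Suc i. M (Suc i) (Suc j) * w (Suc j)) = ((int t)\<^sup>2 + int t) ^ i" for i
  proof (induction i)
    case 0
    then show ?case by (simp add: w_def)
  next
    case (Suc i)
    then show ?case using step[of "Suc i"] by simp
  qed
  moreover have "(\<Sum>j = 1..i. M i j * w j) = (\<Sum>j<i. M i (Suc j) * w (Suc j))" for i
    using sum.atLeast1_atMost_eq[of "\<lambda>j. M i j * w j" i] by simp
  ultimately have row_sum: "(\<Sum>j = 1..Suc i. M (Suc i) j * w j) = ((int t)\<^sup>2 + int t) ^ i" for i
    by (simp only:)
  show ?thesis
  proof (intro allI impI)
    fix i :: nat
    assume "1 \<le> i"
    then have "Suc (i - 1) = i" by simp
    then show "(\<Sum>j = 1..i. M i j * (int t ^ j - (int t - 1) ^ j)) = ((int t)\<^sup>2 + int t) ^ (i - 1)"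
      using row_sum[of "i - 1"] unfolding w_def by (simp only:)
  qed
qed

end
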